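(* Let $\mathbb{A}$ be a finite affine plane of odd order $p$, and consider the switching game on $\mathbb{A}$. Then every configuration with at least one lit bulb is reducible.
   Context: A finite affine plane of order $p$ has $p^2$ points and $p^2+p$ lines, each line contains $p$ points, each point lies on $p+1$ lines, any two points lie on exactly one line, and for each line $L$ and point $P$ not on $L$ there is a unique line through $P$ not meeting $L$ (parallel to $L$). The switching game: there is one light bulb at each point, each either on (lit) or off; there is one switch for each line, and flipping the switch of a line toggles the state of every bulb at a point of that line. A configuration is an assignment of on/off states to all bulbs. A configuration is reducible if some finite sequence of switch flips produces a configuration with strictly fewer lit bulbs than the initial one. *)

theory Defs
  imports Main
begin

text \<open>
  A plane is an incidence structure with an abstract type of lines; \<open>inc x l\<close> means that
  the point \<open>x\<close> lies on the line \<open>l\<close>.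
\<close>

locale finite_affine_plane =
  fixes Points :: "'p set"
    and Lines :: "'l set"
    and inc :: "'p \<Rightarrow> 'l \<Rightarrow> bool"
    and p :: nat
  assumes finite_Points: "finite Points"
    and finite_Lines: "finite Lines"
    and card_Points: "card Points = p ^ 2"
    and card_Lines: "card Lines = p ^ 2 + p"
    and card_points_on_line: "l \<in> Lines \<Longrightarrow> card {x \<in> Points. inc x l} = p"
    and card_lines_through_point: "x \<in> Points \<Longrightarrow> card {l \<in> Lines. inc x l} = p + 1"
    and unique_join:
      "x \<in> Points \<Longrightarrow> y \<in> Points \<Longrightarrow> x \<noteq> y \<Longrightarrow> \<exists>!l. l \<in> Lines \<and> inc x l \<and> inc y l"
    and unique_parallel:
      "l \<in> Lines \<Longrightarrow> x \<in> Points \<Longrightarrow> \<not> inc x l \<Longrightarrow>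
        \<exists>!m. m \<in> Lines \<and> inc x m \<and> \<not> (\<exists>y \<in> Points. inc y l \<and> inc y m)"

text \<open>
  A configuration is a predicate on bulbs, \<open>True\<close> meaning lit; its values outside
  \<open>Points\<close> are irrelevant.
\<close>

type_synonym 'p configuration = "'p \<Rightarrow> bool"

definition lit :: "'p set \<Rightarrow> 'p configuration \<Rightarrow> 'p set" where
  "lit Points c = {x \<in> Points. c x}"

definition flip ::
  "'p set \<Rightarrow> ('p \<Rightarrow> 'l \<Rightarrow> bool) \<Rightarrow> 'l \<Rightarrow> 'p configuration \<Rightarrow> 'p configuration" where
  "flip Points inc l c = (\<lambda>x. if x \<in> Points \<and> inc x l then \<not> c x else c x)"

definition reducible ::
  "'p set \<Rightarrow> 'l set \<Rightarrow> ('p \<Rightarrow> 'l \<Rightarrow> bool) \<Rightarrow> 'p configuration \<Rightarrow> bool" where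
  "reducible Points Lines inc c \<longleftrightarrow>
    (\<exists>ls. set ls \<subseteq> Lines \<and>
      card (lit Points (fold (flip Points inc) ls c)) < card (lit Points c))"

end

theory Submission
  imports Defs
begin

text \<open>
  Flip every line through every lit point. A point \<open>x\<close> is toggled once for each lit \<open>y \<noteq> x\<close>, and
  \<open>p + 1\<close> times more if it is lit itself. As \<open>p\<close> is odd, an even number of lit bulbs makes this
  toggle exactly the lit ones, so that all bulbs go off. If the number of lit bulbs is odd,
  first flip any one line: it has an odd number of points, so the number of lit bulbs becomes even.
\<close>

text \<open>Each flip of a line through \<open>x\<close> negates the bulb there and other flips
  leave it alone, so only the parity of their number counts, not their order. Repetitions in
  \<open>ls\<close> are allowed.\<close>

lemma fold_flip:
  assumes "x \<in> Points"
  shows "fold (flip Points inc) ls c x \<longleftrightarrow> (c x \<noteq> odd (length (filter (inc x) ls)))"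
  using assms by (induction ls arbitrary: c) (auto simp: flip_def)

text \<open>The two cardinalities together count the intersection twice, which does not affect
  parity. Flipping a line acts on the set of lit points as such a symmetric difference.\<close>

lemma even_card_Diff_Un_Diff:
  assumes "finite A" "finite B"
  shows "even (card ((A - B) \<union> (B - A))) \<longleftrightarrow> even (card A + card B)"
proof -
  have "card ((A - B) \<union> (B - A)) = card (A - B) + card (B - A)"
    using assms by (intro card_Un_disjoint) auto
  moreover have "card A = card (A - B) + card (A \<inter> B)"
    using assms by (subst card_Un_disjoint [symmetric]) (auto intro: arg_cong [where f = card])
  moreover have "card B = card (B - A) + card (A \<inter> B)"
    using assms by (subst card_Un_disjoint [symmetric]) (auto intro: arg_cong [where f = card])
  ultimately show ?thesis by auto
qed

context finite_affine_plane
begin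

lemma card_common_lines:
  assumes "x \<in> Points" "y \<in> Points"
  shows "card {l \<in> Lines. inc y l \<and> inc x l} = (if x = y then p + 1 else 1)"
proof (cases "x = y")
  case True
  then show ?thesis using assms card_lines_through_point by simp
next
  case False
  obtain l where "{l \<in> Lines. inc y l \<and> inc x l} = {l}"
    using unique_join [OF assms False] by blast
  then show ?thesis using False by simp
qed

lemma extinguish_even:
  assumes "odd p" and even: "even (card (lit Points c))"
  obtains ls where "set ls \<subseteq> Lines" "lit Points (fold (flip Points inc) ls c) = {}"
proof -
  obtain ys where ys: "set ys = lit Points c" "distinct ys"
    using finite_distinct_list [of "lit Points c"] finite_Points by (auto simp: lit_def)
  obtain L where L: "set L = Lines" "distinct L"
    using finite_distinct_list [OF finite_Lines] by blast
  \<comment> \<open>A line is listed once for each lit point on it; these multiplicities are what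
    makes the count below exact.\<close>
  define ls where "ls = concat (map (\<lambda>y. filter (inc y) L) ys)"
  have count: "odd (length (filter (inc x) ls)) \<longleftrightarrow> c x" if x: "x \<in> Points" for x
  proof -
    \<comment> \<open>The \<open>p + 1\<close> lines of the case \<open>x = y\<close> are split as
      \<open>1 + p\<close>, so that the sum over all lit \<open>y\<close> separates into the number
      of lit points and a single term \<open>p\<close> for a lit \<open>x\<close>.\<close>
    have single: "length (filter (inc x) (filter (inc y) L)) = 1 + (if x = y then p else 0)"
      if "y \<in> set ys" for y
    proof -
      have "length (filter (inc x) (filter (inc y) L)) = card {l \<in> Lines. inc y l \<and> inc x l}"
        using L distinct_card [of "filter (inc x) (filter (inc y) L)"] by (simp add: conj_assoc)
      then show ?thesis
        using that x ys card_common_lines [of x y] by (simp add: lit_def)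
    qed
    have "length (filter (inc x) ls) = (\<Sum>y\<leftarrow>ys. length (filter (inc x) (filter (inc y) L)))"
      by (simp add: ls_def filter_concat length_concat comp_def)
    also have "\<dots> = (\<Sum>y\<in>lit Points c. length (filter (inc x) (filter (inc y) L)))"
      using ys by (simp add: sum_list_distinct_conv_sum_set)
    also have "\<dots> = (\<Sum>y\<in>lit Points c. 1 + (if x = y then p else 0))"
      using single ys by (intro sum.cong) auto
    also have "\<dots> = card (lit Points c) + (if c x then p else 0)"
      using x finite_Points by (simp only: sum.distrib) (simp add: lit_def)
    \<comment> \<open>Modulo 2 the first summand vanishes and \<open>p\<close> is 1.\<close>
    finally show ?thesis using assms by simp
  qed
  show thesis
  proof
    show "set ls \<subseteq> Lines" using L by (auto simp: ls_def)
    show "lit Points (fold (flip Points inc) ls c) = {}"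
      using count by (auto simp: lit_def fold_flip)
  qed
qed

lemma extinguish:
  assumes "odd p" and "Lines \<noteq> {}"
  obtains ls where "set ls \<subseteq> Lines" "lit Points (fold (flip Points inc) ls c) = {}"
proof (cases "even (card (lit Points c))")
  case True
  then show thesis using extinguish_even [OF \<open>odd p\<close>] that by blast
next
  case False
  obtain l where l: "l \<in> Lines" using assms by blast
  let ?l = "{x \<in> Points. inc x l}"
  have "lit Points (flip Points inc l c) = (lit Points c - ?l) \<union> (?l - lit Points c)"
    by (auto simp: lit_def flip_def)
  moreover have "finite (lit Points c)" "finite ?l"
    using finite_Points by (auto simp: lit_def)
  ultimately have "even (card (lit Points (flip Points inc l c)))"
    using even_card_Diff_Un_Diff [of "lit Points c" ?l] False \<open>odd p\<close> card_points_on_line [OF l]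
    by simp
  then obtain ls where "set ls \<subseteq> Lines"
      "lit Points (fold (flip Points inc) ls (flip Points inc l c)) = {}"
    using extinguish_even [OF \<open>odd p\<close>] by blast
  \<comment> \<open>\<open>fold\<close> processes the head of the list first, so \<open>l\<close> is
    flipped before \<open>ls\<close>.\<close>
  then show thesis using that [of "l # ls"] l by simp
qed

end

theorem theorem4:
  fixes Points :: "'p set"
    and Lines :: "'l set"
    and inc :: "'p \<Rightarrow> 'l \<Rightarrow> bool"
    and p :: nat
    and c :: "'p configuration"
  assumes "finite_affine_plane Points Lines inc p"
    and "odd p"
    and "lit Points c \<noteq> {}"
  shows "reducible Points Lines inc c"
proof -
  interpret finite_affine_plane Points Lines inc p by fact
  \<comment> \<open>Oddness excludes \<open>p = 0\<close>, so \<open>p ^ 2 + p\<close> is positive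
    and there is a line to flip in the odd case.\<close>
  have "card Lines \<noteq> 0" using \<open>odd p\<close> card_Lines by (auto elim: oddE)
  then have "Lines \<noteq> {}" by auto
  then obtain ls where "set ls \<subseteq> Lines" "lit Points (fold (flip Points inc) ls c) = {}"
    using extinguish [OF \<open>odd p\<close>] by blast
  moreover have "card (lit Points c) > 0"
    using assms(3) finite_Points by (simp add: card_gt_0_iff lit_def)
  ultimately show ?thesis unfolding reducible_def by (metis card.empty)
qed

end
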